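(* Consider the problem of selling a single indivisible good with verification (quantity space $Q=[0,1]$, exponential authentication rate $\alpha$ with local precision function $\lambda$, type density $f$, and cost $c(q)=cq$ with a constant $0\le c<\bar\theta$). Assume that the virtual value $$\varphi(\theta)=\theta-\frac{1}{f(\theta)}\int_\theta^{\bar\theta}\alpha(\theta|\xi)f(\xi)\,d\xi$$ is strictly increasing. Then the optimal quantity function $q^\ast$ and transfer function $t^\ast$ (i.e. the solution of the principal's problem) are essentially unique and given as follows. Let $\theta^\ast=\varphi^{-1}(c)$. If $\theta<\theta^\ast$, then $q^\ast(\theta)=t^\ast(\theta)=0$. If $\theta\ge\theta^\ast$, then $q^\ast(\theta)=1$ and $$t^\ast(\theta)=\theta^\ast+\int_{\theta^\ast}^{\theta}(1-\alpha(\xi|\theta))\,d\xi .$$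
   Context: Types: $\Theta=[\underline\theta,\bar\theta]$ with $\bar\theta>\underline\theta\ge0$; the type has distribution function $F$ with strictly positive density $f$ on $\Theta$. Authentication rate: for a given continuous $\lambda\colon[\underline\theta,\bar\theta]\to\mathbb{R}_+$, $$\alpha(\theta'|\theta)=\exp\Big(-\Big|\int_{\theta'}^{\theta}\lambda(\xi)\,d\xi\Big|\Big),\qquad\theta,\theta'\in\Theta.$$ Here $\alpha(\theta'|\theta)$ is the probability with which type $\theta$ is authenticated as type $\theta'$. Quantity space $Q=[0,1]$ (quantity is the probability of allocating the good), and $c$ is the cost of producing a single good. A mechanism is a pair of (universally) measurable functions $q\colon\Theta\to Q$ and $t\colon\Theta\to\mathbb{R}$. The principal's problem is $$\text{maximize}\ \int_{\underline\theta}^{\bar\theta}[t(\theta)-c\,q(\theta)]f(\theta)\,d\theta$$ subject to $$\theta q(\theta)-t(\theta)\ge\alpha(\theta'|\theta)\,[\theta q(\theta')-t(\theta')]\quad\text{for all }\theta,\theta'\in\Theta,\qquad \theta q(\theta)-t(\theta)\ge0\quad\text{for all }\theta\in\Theta.$$ A mechanism is optimal if it solves this problem. Essentially unique means that all optimal mechanisms agree at almost every type. *)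

theory Defs
  imports "HOL-Analysis.Analysis"
begin

text \<open>Universal measurability on \<open>S\<close>: measurability with respect to the completion of every
  finite Borel measure on \<open>S\<close>.\<close>

definition universally_measurable_on :: "'a::topological_space set \<Rightarrow> ('a \<Rightarrow> real) \<Rightarrow> bool" where
  "universally_measurable_on S g \<longleftrightarrow>
     (\<forall>M. finite_measure M \<longrightarrow> sets M = sets (restrict_space borel S) \<longrightarrow>
        g \<in> borel_measurable (completion M))"

text \<open>\<open>auth_rate lam \<theta>' \<theta>\<close> is the rate \<open>\<alpha>(\<theta>'|\<theta>)\<close>: the report comes first, the true type second.
  The interval integral is oriented, so both orders of the arguments are covered.\<close>

definition auth_rate :: "(real \<Rightarrow> real) \<Rightarrow> real \<Rightarrow> real \<Rightarrow> real" where
  "auth_rate lam \<theta>' \<theta> = exp (- \<bar>LBINT \<xi>=\<theta>'..\<theta>. lam \<xi>\<bar>)"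

definition mechanism :: "real \<Rightarrow> real \<Rightarrow> (real \<Rightarrow> real) \<Rightarrow> (real \<Rightarrow> real) \<Rightarrow> bool" where
  "mechanism lo hi q t \<longleftrightarrow>
     universally_measurable_on {lo..hi} q \<and> universally_measurable_on {lo..hi} t \<and>
     (\<forall>\<theta>\<in>{lo..hi}. q \<theta> \<in> {0..1})"

definition incentive_compatible ::
  "real \<Rightarrow> real \<Rightarrow> (real \<Rightarrow> real) \<Rightarrow> (real \<Rightarrow> real) \<Rightarrow> (real \<Rightarrow> real) \<Rightarrow> bool" where
  "incentive_compatible lo hi lam q t \<longleftrightarrow>
     (\<forall>\<theta>\<in>{lo..hi}. \<forall>\<theta>'\<in>{lo..hi}.
        \<theta> * q \<theta> - t \<theta> \<ge> auth_rate lam \<theta>' \<theta> * (\<theta> * q \<theta>' - t \<theta>'))"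

definition individually_rational ::
  "real \<Rightarrow> real \<Rightarrow> (real \<Rightarrow> real) \<Rightarrow> (real \<Rightarrow> real) \<Rightarrow> bool" where
  "individually_rational lo hi q t \<longleftrightarrow> (\<forall>\<theta>\<in>{lo..hi}. \<theta> * q \<theta> - t \<theta> \<ge> 0)"

definition feasible ::
  "real \<Rightarrow> real \<Rightarrow> (real \<Rightarrow> real) \<Rightarrow> (real \<Rightarrow> real) \<Rightarrow> (real \<Rightarrow> real) \<Rightarrow> bool" where
  "feasible lo hi lam q t \<longleftrightarrow>
     mechanism lo hi q t \<and> incentive_compatible lo hi lam q t \<and> individually_rational lo hi q t"

text \<open>Integrals against the type density use \<open>lebesgue\<close> rather than \<open>lborel\<close>, because universally
  measurable functions need not be Borel. The default value \<open>0\<close> of the integral of a non-integrable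
  function is never used at a feasible mechanism: \<open>t\<close> is bounded above by individual rationality,
  and below by incentive compatibility, as \<open>auth_rate\<close> is bounded away from \<open>0\<close> when \<open>lam\<close> is
  continuous on \<open>{lo..hi}\<close>.\<close>

definition profit ::
  "real \<Rightarrow> real \<Rightarrow> (real \<Rightarrow> real) \<Rightarrow> real \<Rightarrow> (real \<Rightarrow> real) \<Rightarrow> (real \<Rightarrow> real) \<Rightarrow> real" where
  "profit lo hi f c q t = (LINT \<theta>:{lo..hi}|lebesgue. (t \<theta> - c * q \<theta>) * f \<theta>)"

definition optimal ::
  "real \<Rightarrow> real \<Rightarrow> (real \<Rightarrow> real) \<Rightarrow> (real \<Rightarrow> real) \<Rightarrow> real \<Rightarrow>
     (real \<Rightarrow> real) \<Rightarrow> (real \<Rightarrow> real) \<Rightarrow> bool" where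
  "optimal lo hi lam f c q t \<longleftrightarrow>
     feasible lo hi lam q t \<and>
     (\<forall>q' t'. feasible lo hi lam q' t' \<longrightarrow> profit lo hi f c q' t' \<le> profit lo hi f c q t)"

definition virtual_value ::
  "real \<Rightarrow> (real \<Rightarrow> real) \<Rightarrow> (real \<Rightarrow> real) \<Rightarrow> real \<Rightarrow> real" where
  "virtual_value hi lam f \<theta> =
     \<theta> - 1 / f \<theta> * (LINT \<xi>:{\<theta>..hi}|lebesgue. auth_rate lam \<theta> \<xi> * f \<xi>)"

text \<open>The inverse \<open>\<phi>\<inverse>(c)\<close> of a strictly increasing function on \<open>{lo..hi}\<close>. It is the preimage of \<open>c\<close>
  whenever there is one. The generalised inverse is needed since the virtual value may exceed \<open>c\<close>
  at every type (then the value is \<open>lo\<close>) or, for a discontinuous density, jump across \<open>c\<close>.\<close>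

definition threshold :: "real \<Rightarrow> real \<Rightarrow> (real \<Rightarrow> real) \<Rightarrow> real \<Rightarrow> real" where
  "threshold lo hi \<phi> c = Inf {\<theta>\<in>{lo..hi}. c \<le> \<phi> \<theta>}"

lemma threshold_eq_preimage:
  assumes "strict_mono_on {lo..hi} \<phi>" and "\<theta> \<in> {lo..hi}" and "\<phi> \<theta> = c"
  shows "threshold lo hi \<phi> c = \<theta>"
  unfolding threshold_def
proof (rule cInf_eq_minimum)
  show "\<theta> \<in> {\<theta>\<in>{lo..hi}. c \<le> \<phi> \<theta>}"
    using assms by simp
  show "\<theta> \<le> x" if "x \<in> {\<theta>\<in>{lo..hi}. c \<le> \<phi> \<theta>}" for x
    using that assms strict_mono_onD[OF assms(1), of x \<theta>] by fastforce
qed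

definition opt_quantity :: "real \<Rightarrow> real \<Rightarrow> real" where
  "opt_quantity \<theta>s \<theta> = (if \<theta> < \<theta>s then 0 else 1)"

definition opt_transfer :: "(real \<Rightarrow> real) \<Rightarrow> real \<Rightarrow> real \<Rightarrow> real" where
  "opt_transfer lam \<theta>s \<theta> =
     (if \<theta> < \<theta>s then 0 else \<theta>s + (LBINT \<xi>=\<theta>s..\<theta>. 1 - auth_rate lam \<xi> \<theta>))"

end

theory Submission
  imports Defs
begin

text \<open>
  Write \<open>\<alpha>(x|y) = E x / E y\<close> for \<open>x \<le> y\<close>, where \<open>E\<close> is the exponential of a primitive of \<open>lam\<close>.
  Only downward misreports matter: with \<open>U \<theta> = \<theta> q \<theta> - t \<theta>\<close>, they say that the increment of \<open>E U\<close>
  from \<open>x\<close> to \<open>y\<close> is at least \<open>(y - x) E x q x\<close>. Hence \<open>U\<close> is at least the rent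
  \<open>(\<integral>\<^bsub>lo\<^esub>\<^bsup>\<theta>\<^esup> E q) / E \<theta>\<close>, and exchanging the order of integration bounds the profit by
  \<open>\<integral> q (\<phi> - c) f\<close>, which is maximised pointwise by the cutoff at the threshold. Conversely, every
  increasing quantity function is implemented by its rent, so the bound is attained. For
  uniqueness, both inequalities have to be equalities almost everywhere.
\<close>

section \<open>Universal, Borel and Lebesgue measurability\<close>

text \<open>Lebesgue measure on \<open>{a..b}\<close> is one of the finite measures in the
  definition. Measurability for its completion means agreement almost everywhere with a Borel
  function.\<close>

lemma universally_measurable_on_imp_lebesgue:
  fixes g :: "real \<Rightarrow> real"
  assumes "universally_measurable_on {a..b} g"
  shows "g \<in> borel_measurable (lebesgue_on {a..b})"
proof -
  let ?M = "restrict_space lborel {a..b}"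
  have "finite_measure ?M"
    by (rule finite_measureI) (simp add: emeasure_restrict_space space_restrict_space emeasure_lborel_Icc_eq)
  moreover have "sets ?M = sets (restrict_space borel {a..b})"
    by (rule sets_restrict_space_cong) simp
  ultimately have "g \<in> borel_measurable (completion ?M)"
    using assms unfolding universally_measurable_on_def by blast
  then obtain g' where g': "g' \<in> borel_measurable ?M" and eq: "AE x in ?M. g x = g' x"
    using completion_ex_borel_measurable_real by blast
  have "(\<lambda>x. indicator {a..b} x * g' x) \<in> borel_measurable lborel"
    using g' by (simp add: borel_measurable_restrict_space_iff)
  then have "(\<lambda>x. indicator {a..b} x * g' x) \<in> borel_measurable lebesgue"
    by (rule measurable_completion)
  moreover have "AE x in lborel. x \<in> {a..b} \<longrightarrow> g x = g' x"
    using eq by (simp add: AE_restrict_space_iff)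
  then have "AE x in lborel. indicator {a..b} x * g' x = indicator {a..b} x * g x"
    by eventually_elim (simp add: indicator_def)
  then have "AE x in lebesgue. indicator {a..b} x * g' x = indicator {a..b} x * g x"
    by (rule AE_completion)
  ultimately have "(\<lambda>x. indicator {a..b} x * g x) \<in> borel_measurable lebesgue"
    by (rule borel_measurable_AE)
  then show ?thesis
    by (simp add: borel_measurable_restrict_space_iff)
qed

lemma borel_imp_universally_measurable_on:
  assumes "g \<in> borel_measurable (restrict_space borel S)"
  shows "universally_measurable_on S g"
  unfolding universally_measurable_on_def
  using assms measurable_cong_sets[of _ "restrict_space borel S" borel borel]
  by (metis measurable_completion)

text \<open>The space of every admissible \<open>M\<close> is \<open>S\<close>, so values off
  \<open>S\<close> do not matter. This lets a transfer be exchanged for a formula valid only on the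
  type interval.\<close>

lemma universally_measurable_on_cong:
  assumes "\<And>x. x \<in> S \<Longrightarrow> g x = h x"
  shows "universally_measurable_on S g \<longleftrightarrow> universally_measurable_on S h"
proof -
  have "g \<in> borel_measurable (completion M) \<longleftrightarrow> h \<in> borel_measurable (completion M)"
    if "sets M = sets (restrict_space borel S)" for M :: "'a measure"
    using sets_eq_imp_space_eq[OF that] assms
    by (intro measurable_cong) (simp add: space_restrict_space)
  then show ?thesis
    by (auto simp: universally_measurable_on_def)
qed

section \<open>Increments of monotone functions, and Fubini on a triangle\<close>

text \<open>Integrating the hypothesis for \<open>y = x + h\<close> over \<open>x\<close> telescopes the right-hand side to at most
  \<open>h (V b - V a)\<close>; this avoids the differentiability of monotone functions almost everywhere.\<close>

lemma integral_le_increment: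
  fixes V g :: "real \<Rightarrow> real"
  assumes "a \<le> b" and g: "g integrable_on {a..b}" and V: "mono_on {a..b} V"
    and incr: "\<And>x y. \<lbrakk>a \<le> x; x \<le> y; y \<le> b\<rbrakk> \<Longrightarrow> (y - x) * g x \<le> V y - V x"
  shows "integral {a..b} g \<le> V b - V a"
proof (cases "a = b")
  case False
  then have "a < b" using \<open>a \<le> b\<close> by simp
  have Vint: "V integrable_on {x..y}" if "a \<le> x" "y \<le> b" for x y
    using V that by (intro integrable_on_mono_on) (auto intro: mono_on_subset)
  have le: "integral {a..b - h} g \<le> V b - V a" if h: "0 < h" "h < b - a" for h
  proof -
    have V_shift: "((\<lambda>x. V (x + h)) has_integral integral {a + h..b} V) {a..b - h}"
      using has_integral_affinity'[of V "integral {a + h..b} V" "a + h" b 1 h] Vint[of "a + h" b] h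
      by (simp add: integrable_integral)
    have diff: "((\<lambda>x. V (x + h) - V x) has_integral
        integral {a + h..b} V - integral {a..b - h} V) {a..b - h}"
      using V_shift integrable_integral[OF Vint[of a "b - h"]] h by (intro has_integral_diff) auto
    have "((\<lambda>x. h * g x) has_integral h * integral {a..b - h} g) {a..b - h}"
      using integrable_integral[OF integrable_subinterval_real[OF g, of a "b - h"]] h
      by (intro has_integral_mult_right) auto
    then have "h * integral {a..b - h} g \<le> integral {a + h..b} V - integral {a..b - h} V"
    proof (rule has_integral_le[OF _ diff])
      show "h * g x \<le> V (x + h) - V x" if "x \<in> {a..b - h}" for x
        using incr[of x "x + h"] that h by simp
    qed
    \<comment> \<open>Splitting the integral of \<open>V\<close> over \<open>{a..b}\<close> at
      \<open>a + h\<close> and at \<open>b - h\<close> leaves only two end pieces of length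
      \<open>h\<close>, where \<open>V\<close> is at most \<open>V b\<close> and at least
      \<open>V a\<close>.\<close>
    also have "\<dots> = integral {b - h..b} V - integral {a..a + h} V"
      using Henstock_Kurzweil_Integration.integral_combine[OF _ _ Vint[of a b], of "a + h"]
        Henstock_Kurzweil_Integration.integral_combine[OF _ _ Vint[of a b], of "b - h"] h
      by simp
    finally have "h * integral {a..b - h} g \<le> integral {b - h..b} V - integral {a..a + h} V" .
    moreover have "integral {b - h..b} V \<le> integral {b - h..b} (\<lambda>_. V b)"
      using h by (intro integral_le Vint) (auto intro: mono_onD[OF V])
    moreover have "integral {a..a + h} (\<lambda>_. V a) \<le> integral {a..a + h} V"
      using h by (intro integral_le Vint) (auto intro: mono_onD[OF V])
    ultimately have "h * integral {a..b - h} g \<le> h * (V b - V a)"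
      using h by (simp add: right_diff_distrib)
    then show ?thesis using h by simp
  qed
  \<comment> \<open>The bound is uniform in \<open>h\<close>, so \<open>h\<close> may tend to
    \<open>0\<close>: the indefinite integral of \<open>g\<close> is continuous at
    \<open>b\<close>.\<close>
  have "continuous_on {a..b} (\<lambda>x. integral {a..x} g)"
    by (rule indefinite_integral_continuous_1[OF g])
  then have "((\<lambda>x. integral {a..x} g) \<longlongrightarrow> integral {a..b} g) (at b within {a..b})"
    using \<open>a < b\<close> by (simp add: continuous_on)
  moreover have "at b within {a..b} = at_left b"
    using \<open>a < b\<close> by (rule at_within_Icc_at_left)
  moreover have "\<forall>\<^sub>F x in at_left b. integral {a..x} g \<le> V b - V a"
    unfolding eventually_at_left_field
    using \<open>a < b\<close> le[of "b - x" for x] by (intro exI[of _ a]) auto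
  ultimately show ?thesis
    by (intro tendsto_upperbound[of _ _ "at_left b"]) auto
qed simp

lemma absolutely_integrable_mult_continuous:
  fixes f h :: "real \<Rightarrow> real"
  assumes "f absolutely_integrable_on {a..b}" and "continuous_on {a..b} h"
  shows "(\<lambda>x. h x * f x) absolutely_integrable_on {a..b}"
proof (rule absolutely_integrable_bounded_measurable_product_real[OF _ _ _ assms(1)])
  show "h \<in> borel_measurable (lebesgue_on {a..b})"
    using assms(2) by (intro continuous_imp_measurable_on_sets_lebesgue) auto
  show "bounded (h ` {a..b})"
    using assms(2) by (simp add: compact_continuous_image compact_imp_bounded)
qed auto

lemma integrable_lebesgue_ex_lborel:
  fixes f :: "real \<Rightarrow> real"
  assumes "integrable lebesgue f"
  obtains f' where "integrable lborel f'" and "AE x in lebesgue. f x = f' x"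
proof -
  obtain f' where f': "f' \<in> borel_measurable lborel" and eq: "AE x in lborel. f x = f' x"
    using completion_ex_borel_measurable_real[of f lborel] assms by auto
  have eq': "AE x in lebesgue. f x = f' x"
    using eq by (rule AE_completion)
  then have "integrable lebesgue f'"
    using integrable_cong_AE[of f lebesgue f'] assms f' measurable_completion[OF f'] by auto
  then show ?thesis
    using that eq' f' by (auto simp: integrable_completion)
qed

text \<open>The product of two copies of \<open>lebesgue\<close> is not \<open>lebesgue\<close> on the plane, so Fubini is applied to
  Borel representatives.\<close>

lemma integral_triangle_swap:
  fixes f g :: "real \<Rightarrow> real"
  assumes f: "f absolutely_integrable_on {a..b}" and g: "g absolutely_integrable_on {a..b}"
  shows "integral {a..b} (\<lambda>x. f x * integral {a..x} g) = integral {a..b} (\<lambda>y. g y * integral {y..b} f)"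
proof -
  have integrable': "integrable lebesgue (\<lambda>x. indicator {a..b} x * f x)"
    "integrable lebesgue (\<lambda>x. indicator {a..b} x * g x)"
    using f g by (auto simp: set_integrable_def)
  obtain f' where f': "integrable lborel f'" "AE x in lebesgue. indicator {a..b} x * f x = f' x"
    using integrable_lebesgue_ex_lborel[OF integrable'(1)] .
  obtain g' where g': "integrable lborel g'" "AE x in lebesgue. indicator {a..b} x * g x = g' x"
    using integrable_lebesgue_ex_lborel[OF integrable'(2)] .
  have [measurable]: "f' \<in> borel_measurable borel" "g' \<in> borel_measurable borel"
    using f' g' by auto
  \<comment> \<open>An iterated integral over the triangle, rewritten with Borel representatives.
    The section \<open>S x\<close> is kept general to serve both orders of integration:
    \<open>{..x}\<close> for one, \<open>{x..}\<close> for the other.\<close>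
  have rep: "integral {a..b} (\<lambda>x. u x * integral ({a..b} \<inter> S x) v) =
      (LINT x|lborel. u' x * (LINT y|lborel. indicator (S x) y * v' y))"
    if u: "u absolutely_integrable_on {a..b}" and v: "v absolutely_integrable_on {a..b}"
      and u': "AE x in lebesgue. indicator {a..b} x * u x = u' x"
      and v': "AE x in lebesgue. indicator {a..b} x * v x = v' x"
      and [measurable]: "u' \<in> borel_measurable borel" "v' \<in> borel_measurable borel"
        "\<And>x. S x \<in> sets borel"
        "(\<lambda>x. LINT y|lborel. indicator (S x) y * v' y) \<in> borel_measurable borel"
      and cont: "continuous_on {a..b} (\<lambda>x. integral ({a..b} \<inter> S x) v)"
    for u v u' v' :: "real \<Rightarrow> real" and S :: "real \<Rightarrow> real set"
  proof -
    have inner: "(LINT y|lborel. indicator (S x) y * v' y) = integral ({a..b} \<inter> S x) v" for x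
    proof -
      have vS: "v absolutely_integrable_on {a..b} \<inter> S x"
        using v by (rule set_integrable_subset) auto
      have "(LINT y|lborel. indicator (S x) y * v' y) = (LINT y|lebesgue. indicator (S x) y * v' y)"
        by (rule integral_completion[symmetric]) measurable
      also have "\<dots> = (LINT y:{a..b} \<inter> S x|lebesgue. v y)"
        unfolding set_lebesgue_integral_def
      proof (rule integral_cong_AE)
        show "(\<lambda>y. indicator (S x) y * v' y) \<in> borel_measurable lebesgue"
          by (rule measurable_completion) measurable
        show "(\<lambda>y. indicator ({a..b} \<inter> S x) y *\<^sub>R v y) \<in> borel_measurable lebesgue"
          using vS by (auto simp: set_integrable_def)
        show "AE y in lebesgue. indicator (S x) y * v' y = indicator ({a..b} \<inter> S x) y *\<^sub>R v y"
          using v' by eventually_elim (auto simp: indicator_def split: if_splits)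
      qed
      also have "\<dots> = integral ({a..b} \<inter> S x) v"
        using vS by (rule set_lebesgue_integral_eq_integral)
      finally show ?thesis .
    qed
    have int: "(\<lambda>x. integral ({a..b} \<inter> S x) v * u x) absolutely_integrable_on {a..b}"
      using u cont by (rule absolutely_integrable_mult_continuous)
    have "(LINT x|lborel. u' x * (LINT y|lborel. indicator (S x) y * v' y)) =
        (LINT x|lebesgue. u' x * (LINT y|lborel. indicator (S x) y * v' y))"
      by (rule integral_completion[symmetric]) measurable
    also have "\<dots> = (LINT x:{a..b}|lebesgue. integral ({a..b} \<inter> S x) v * u x)"
      unfolding set_lebesgue_integral_def
    proof (rule integral_cong_AE)
      show "(\<lambda>x. u' x * (LINT y|lborel. indicator (S x) y * v' y)) \<in> borel_measurable lebesgue"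
        by (rule measurable_completion) measurable
      show "(\<lambda>x. indicator {a..b} x *\<^sub>R (integral ({a..b} \<inter> S x) v * u x)) \<in> borel_measurable lebesgue"
        using int by (auto simp: set_integrable_def)
      show "AE x in lebesgue. u' x * (LINT y|lborel. indicator (S x) y * v' y) =
          indicator {a..b} x *\<^sub>R (integral ({a..b} \<inter> S x) v * u x)"
        unfolding inner using u' by eventually_elim (auto simp: indicator_def split: if_splits)
    qed
    also have "\<dots> = integral {a..b} (\<lambda>x. integral ({a..b} \<inter> S x) v * u x)"
      using int by (rule set_lebesgue_integral_eq_integral)
    finally show ?thesis
      by (simp add: mult.commute)
  qed
  have "integrable (lborel \<Otimes>\<^sub>M lborel) (\<lambda>(x, y). f' x * g' y)"
    by (rule lborel_pair.Fubini_integrable) (use f'(1) g'(1) in \<open>auto simp: abs_mult\<close>)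
  moreover have "{z. snd z \<le> fst z} \<in> sets (lborel \<Otimes>\<^sub>M (lborel :: real measure))"
    unfolding lborel_prod sets_lborel by (intro borel_closed closed_Collect_le continuous_intros)
  ultimately have "integrable (lborel \<Otimes>\<^sub>M lborel)
      (\<lambda>z. indicator {z. snd z \<le> fst z} z *\<^sub>R (case z of (x, y) \<Rightarrow> f' x * g' y))"
    by (rule integrable_mult_indicator[rotated])
  then have "integrable (lborel \<Otimes>\<^sub>M lborel) (\<lambda>(x, y). f' x * (indicator {..x} y * g' y))"
    by (rule back_subst[of "integrable _"]) (auto simp: indicator_def)
  from lborel_pair.Fubini_integral[OF this]
  have swap: "(LINT y|lborel. LINT x|lborel. f' x * (indicator {..x} y * g' y)) =
      (LINT x|lborel. f' x * (LINT y|lborel. indicator {..x} y * g' y))"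
    by simp
  \<comment> \<open>The condition \<open>y \<le> x\<close> is read once as a section in
    \<open>y\<close> and once as a section in \<open>x\<close>.\<close>
  have "f' x * (indicator {..x} y * g' y) = g' y * (indicator {y..} x * f' x)" for x y
    by (simp add: indicator_def)
  with swap have swap: "(LINT y|lborel. g' y * (LINT x|lborel. indicator {y..} x * f' x)) =
      (LINT x|lborel. f' x * (LINT y|lborel. indicator {..x} y * g' y))"
    by simp
  have Int: "{a..b} \<inter> {..x} = {a..x}" "{a..b} \<inter> {x..} = {x..b}" if "x \<in> {a..b}" for x
    using that by auto
  have cont: "continuous_on {a..b} (\<lambda>x. integral ({a..b} \<inter> {..x}) g)"
    "continuous_on {a..b} (\<lambda>x. integral ({a..b} \<inter> {x..}) f)"
    using indefinite_integral_continuous_1[OF set_lebesgue_integral_eq_integral(1)[OF g]]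
      indefinite_integral_continuous_1'[OF set_lebesgue_integral_eq_integral(1)[OF f]]
    by (simp_all only: Int cong: continuous_on_cong)
  have meas: "(\<lambda>x. LINT y|lborel. indicator {..x} y * g' y) \<in> borel_measurable borel"
    "(\<lambda>x. LINT y|lborel. indicator {x..} y * f' y) \<in> borel_measurable borel"
    unfolding indicator_def atMost_iff atLeast_iff by measurable
  have "integral {a..b} (\<lambda>x. f x * integral {a..x} g) =
      integral {a..b} (\<lambda>x. f x * integral ({a..b} \<inter> {..x}) g)"
    by (intro integral_cong) (simp add: Int)
  also have "\<dots> = (LINT x|lborel. f' x * (LINT y|lborel. indicator {..x} y * g' y))"
    using f g f' g' cont meas by (intro rep) auto
  also have "\<dots> = (LINT y|lborel. g' y * (LINT x|lborel. indicator {y..} x * f' x))"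
    by (rule swap[symmetric])
  also have "\<dots> = integral {a..b} (\<lambda>y. g y * integral ({a..b} \<inter> {y..}) f)"
    using f g f' g' cont meas by (intro rep[symmetric]) auto
  also have "\<dots> = integral {a..b} (\<lambda>y. g y * integral {y..b} f)"
    by (intro integral_cong) (simp add: Int)
  finally show ?thesis .
qed


lemma integral_eq_0_AE:
  fixes h :: "real \<Rightarrow> real"
  assumes h: "h absolutely_integrable_on S" and nonneg: "\<And>x. x \<in> S \<Longrightarrow> 0 \<le> h x"
    and zero: "integral S h = 0"
  shows "AE x in lebesgue. x \<in> S \<longrightarrow> h x = 0"
proof -
  have int: "integrable lebesgue (\<lambda>x. indicator S x * h x)"
    using h by (simp add: set_integrable_def)
  have "(LINT x|lebesgue. indicator S x * h x) = 0"
    using set_lebesgue_integral_eq_integral(2)[OF h] zero by (simp add: set_lebesgue_integral_def)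
  moreover have "AE x in lebesgue. 0 \<le> indicator S x * h x"
    using nonneg by (auto simp: indicator_def)
  ultimately have "AE x in lebesgue. indicator S x * h x = 0"
    using integral_nonneg_eq_0_iff_AE[OF int] by simp
  then show ?thesis
    by eventually_elim (auto simp: indicator_def split: if_splits)
qed

section \<open>The authentication rate as a ratio\<close>

locale screening =
  fixes lo hi c :: real and lam f :: "real \<Rightarrow> real"
  assumes lo_less_hi: "lo < hi"
    and lam_cont: "continuous_on {lo..hi} lam"
    and lam_nonneg: "\<And>\<theta>. \<theta> \<in> {lo..hi} \<Longrightarrow> 0 \<le> lam \<theta>"
    and f_pos: "\<And>\<theta>. \<theta> \<in> {lo..hi} \<Longrightarrow> 0 < f \<theta>"
    and f_int: "f absolutely_integrable_on {lo..hi}"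
    and c_less_hi: "c < hi"
    and vv_mono: "strict_mono_on {lo..hi} (virtual_value hi lam f)"
begin

definition E :: "real \<Rightarrow> real" where
  "E \<theta> = exp (integral {lo..\<theta>} lam)"

lemma E_pos [simp]: "0 < E \<theta>"
  by (simp add: E_def)

lemma E_nonneg [simp]: "0 \<le> E \<theta>"
  by (simp add: E_def)

lemma E_nonzero [simp]: "E \<theta> \<noteq> 0"
  by (simp add: E_def)

lemma lam_integrable: "\<lbrakk>lo \<le> x; y \<le> hi\<rbrakk> \<Longrightarrow> lam integrable_on {x..y}"
  using lam_cont by (intro integrable_continuous_real) (auto intro: continuous_on_subset)

lemma E_cont: "continuous_on {lo..hi} E"
  unfolding E_def by (intro continuous_intros indefinite_integral_continuous_1 lam_integrable) auto

lemma E_eq_mult: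
  assumes "lo \<le> x" "x \<le> y" "y \<le> hi"
  shows "E y = E x * exp (integral {x..y} lam)"
  using Henstock_Kurzweil_Integration.integral_combine[OF _ _ lam_integrable[of lo y], of x] assms
  by (simp add: E_def flip: exp_add)

lemma lam_integral_nonneg: "\<lbrakk>lo \<le> x; y \<le> hi\<rbrakk> \<Longrightarrow> 0 \<le> integral {x..y} lam"
  by (intro integral_nonneg lam_integrable lam_nonneg) auto

lemma E_mono:
  assumes "lo \<le> x" "x \<le> y" "y \<le> hi"
  shows "E x \<le> E y"
  using lam_integral_nonneg[of x y] assms by (simp add: E_eq_mult[OF assms])

text \<open>As \<open>lam\<close> is nonnegative, its integral over \<open>{x..y}\<close> is too,
  and the absolute value drops out.\<close>

lemma auth_rate_below:
  assumes "lo \<le> x" "x \<le> y" "y \<le> hi"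
  shows "auth_rate lam x y = E x / E y"
proof -
  have "continuous_on {x..y} lam"
    using lam_cont assms by (auto intro: continuous_on_subset)
  then have "(LBINT \<xi>=x..y. lam \<xi>) = integral {x..y} lam"
    using assms by (intro interval_integral_eq_integral borel_integrable_atLeastAtMost') auto
  then show ?thesis
    using lam_integral_nonneg[of x y] assms
    by (simp add: auth_rate_def E_eq_mult[OF assms] exp_minus field_simps)
qed

text \<open>Reversing the endpoints only changes the sign under the absolute value, so the rate is
  symmetric.\<close>

lemma auth_rate_above:
  assumes "lo \<le> x" "x \<le> y" "y \<le> hi"
  shows "auth_rate lam y x = E x / E y"
  using auth_rate_below[OF assms] interval_integral_endpoints_reverse[of y x lam]
  by (simp add: auth_rate_def)

section \<open>Rents and the lower bound on utility\<close>

text \<open>Where \<open>q\<close> is continuous, this solves \<open>U' = q - lam * U\<close> with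
  \<open>U lo = 0\<close>, and \<open>E\<close> is the integrating factor.\<close>

definition rent :: "(real \<Rightarrow> real) \<Rightarrow> real \<Rightarrow> real" where
  "rent q \<theta> = integral {lo..\<theta>} (\<lambda>s. E s * q s) / E \<theta>"

definition quantity :: "(real \<Rightarrow> real) \<Rightarrow> bool" where
  "quantity q \<longleftrightarrow> q \<in> borel_measurable (lebesgue_on {lo..hi}) \<and> (\<forall>\<theta>\<in>{lo..hi}. q \<theta> \<in> {0..1})"

lemma mechanism_imp_quantity: "mechanism lo hi q t \<Longrightarrow> quantity q"
  by (auto simp: mechanism_def quantity_def intro: universally_measurable_on_imp_lebesgue)

lemma quantity_mult:
  assumes "quantity q" and "g absolutely_integrable_on {lo..hi}"
  shows "(\<lambda>s. q s * g s) absolutely_integrable_on {lo..hi}"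
proof (rule absolutely_integrable_bounded_measurable_product_real[OF _ _ _ assms(2)])
  show "q \<in> borel_measurable (lebesgue_on {lo..hi})"
    using assms(1) by (simp add: quantity_def)
  show "bounded (q ` {lo..hi})"
    by (rule bounded_subset[of "{0..1}"]) (use assms(1) in \<open>auto simp: quantity_def\<close>)
qed auto

lemma E_quantity: "quantity q \<Longrightarrow> (\<lambda>s. E s * q s) absolutely_integrable_on {lo..hi}"
  using quantity_mult[OF _ absolutely_integrable_continuous_real[OF E_cont]]
  by (simp add: mult.commute)

lemma E_quantity_integrable:
  assumes "quantity q" and "lo \<le> x" "y \<le> hi"
  shows "(\<lambda>s. E s * q s) integrable_on {x..y}"
  using set_lebesgue_integral_eq_integral(1)[OF E_quantity[OF assms(1)]] assms(2,3)
  by (auto intro: integrable_subinterval_real)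

lemma rent_cont: "quantity q \<Longrightarrow> continuous_on {lo..hi} (rent q)"
  unfolding rent_def
  by (intro continuous_intros indefinite_integral_continuous_1 E_quantity_integrable E_cont) auto

lemma rent_nonneg:
  assumes "quantity q" and "\<theta> \<in> {lo..hi}"
  shows "0 \<le> rent q \<theta>"
  unfolding rent_def using assms
  by (intro divide_nonneg_pos integral_nonneg E_quantity_integrable) (auto simp: quantity_def)

text \<open>If authenticated as \<open>x\<close>, type \<open>y\<close> gets the utility of
  \<open>x\<close> plus \<open>(y - x) * q x\<close>. The constraint is multiplied by
  \<open>E y\<close>.\<close>

lemma downward_ic:
  assumes "incentive_compatible lo hi lam q t" and "lo \<le> x" "x \<le> y" "y \<le> hi"
  shows "E x * (x * q x - t x) + (y - x) * (E x * q x) \<le> E y * (y * q y - t y)"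
proof -
  have "E x / E y * (y * q x - t x) \<le> y * q y - t y"
    using assms by (auto simp: incentive_compatible_def auth_rate_below[symmetric])
  then have "E x * (y * q x - t x) \<le> E y * (y * q y - t y)"
    by (simp add: field_simps)
  then show ?thesis
    by (simp add: algebra_simps)
qed

text \<open>Nonnegative quantities make the increments in \<open>downward_ic\<close> nonnegative.
  Measurability and bounds for the weighted utility are read off from this monotonicity.\<close>

lemma feasible_weighted_utility_mono:
  assumes "feasible lo hi lam q t"
  shows "mono_on {lo..hi} (\<lambda>\<theta>. E \<theta> * (\<theta> * q \<theta> - t \<theta>))"
proof (rule mono_onI)
  fix x y assume xy: "x \<in> {lo..hi}" "y \<in> {lo..hi}" "x \<le> y"
  have "0 \<le> (y - x) * (E x * q x)"
    using xy assms by (simp add: feasible_def mechanism_def)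
  then show "E x * (x * q x - t x) \<le> E y * (y * q y - t y)"
    using downward_ic[of q t x y] assms xy by (simp add: feasible_def)
qed

text \<open>The downward increments are accumulated from \<open>lo\<close> to
  \<open>\<theta>\<close> by \<open>integral_le_increment\<close>. The starting value
  \<open>?V lo\<close> is nonnegative by individual rationality and is dropped.\<close>

lemma rent_le_utility:
  assumes feas: "feasible lo hi lam q t" and \<theta>: "\<theta> \<in> {lo..hi}"
  shows "rent q \<theta> \<le> \<theta> * q \<theta> - t \<theta>"
proof -
  let ?V = "\<lambda>\<theta>. E \<theta> * (\<theta> * q \<theta> - t \<theta>)"
  have q: "quantity q" and ic: "incentive_compatible lo hi lam q t"
    and ir: "individually_rational lo hi q t"
    using feas mechanism_imp_quantity by (auto simp: feasible_def)
  have "integral {lo..\<theta>} (\<lambda>s. E s * q s) \<le> ?V \<theta> - ?V lo"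
  proof (rule integral_le_increment)
    show "mono_on {lo..\<theta>} ?V"
      using feasible_weighted_utility_mono[OF feas] \<theta> by (auto intro: mono_on_subset)
    show "(y - x) * (E x * q x) \<le> ?V y - ?V x" if "lo \<le> x" "x \<le> y" "y \<le> \<theta>" for x y
      using downward_ic[OF ic, of x y] that \<theta> by simp
  qed (use \<theta> q in \<open>auto intro: E_quantity_integrable\<close>)
  also have "\<dots> \<le> ?V \<theta>"
    using ir lo_less_hi by (auto simp: individually_rational_def)
  finally show ?thesis
    by (simp add: rent_def field_simps)
qed

text \<open>The weighted utility is monotone, hence bounded and measurable; the weight is then
  removed by the continuous factor \<open>inverse (E \<theta>)\<close>.\<close>

lemma utility_integrable:
  assumes feas: "feasible lo hi lam q t"
  shows "(\<lambda>\<theta>. (\<theta> * q \<theta> - t \<theta>) * f \<theta>) absolutely_integrable_on {lo..hi}"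
proof -
  let ?V = "\<lambda>\<theta>. E \<theta> * (\<theta> * q \<theta> - t \<theta>)"
  have mono: "mono_on {lo..hi} ?V"
    by (rule feasible_weighted_utility_mono[OF feas])
  have "(\<lambda>\<theta>. ?V \<theta> * f \<theta>) absolutely_integrable_on {lo..hi}"
  proof (rule absolutely_integrable_bounded_measurable_product_real[OF _ _ _ f_int])
    show "?V \<in> borel_measurable (lebesgue_on {lo..hi})"
      using integrable_mono_on[OF mono] by (rule borel_measurable_integrable)
    show "bounded (?V ` {lo..hi})"
      by (rule bounded_subset[of "{?V lo..?V hi}"]) (auto intro!: mono_onD[OF mono])
  qed auto
  from absolutely_integrable_mult_continuous[OF this, of "\<lambda>\<theta>. inverse (E \<theta>)"]
  show ?thesis
    by (simp add: continuous_intros E_cont flip: mult.assoc)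
qed

section \<open>Profit as virtual surplus minus excess utility\<close>

text \<open>The profit that \<open>q\<close> would yield if every type were left with exactly its
  rent, see \<open>virtual_surplus_eq\<close>.\<close>

definition virtual_surplus :: "(real \<Rightarrow> real) \<Rightarrow> real" where
  "virtual_surplus q = integral {lo..hi} (\<lambda>s. q s * ((virtual_value hi lam f s - c) * f s))"

lemma f_div_E_int: "(\<lambda>s. f s / E s) absolutely_integrable_on {lo..hi}"
  using absolutely_integrable_mult_continuous[OF f_int, of "\<lambda>s. inverse (E s)"]
  by (simp add: continuous_intros E_cont divide_inverse mult.commute)

text \<open>All types in the integral lie above \<open>s\<close>, so the rate is
  \<open>E s / E \<xi>\<close> and \<open>E s\<close> moves out of the integral. What remains of the
  information cost is a continuous function of \<open>s\<close>.\<close>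

lemma virtual_value_eq:
  assumes s: "s \<in> {lo..hi}"
  shows "(virtual_value hi lam f s - c) * f s =
    (s - c) * f s - E s * integral {s..hi} (\<lambda>\<xi>. f \<xi> / E \<xi>)"
proof -
  have int: "(\<lambda>\<xi>. E s * (f \<xi> / E \<xi>)) absolutely_integrable_on {s..hi}"
    using absolutely_integrable_on_subinterval[OF f_div_E_int, of s hi] s
    by (intro set_integrable_mult_right) auto
  have "(LINT \<xi>:{s..hi}|lebesgue. auth_rate lam s \<xi> * f \<xi>) =
      (LINT \<xi>:{s..hi}|lebesgue. E s * (f \<xi> / E \<xi>))"
    using s by (intro set_lebesgue_integral_cong) (auto simp: auth_rate_below)
  also have "\<dots> = E s * integral {s..hi} (\<lambda>\<xi>. f \<xi> / E \<xi>)"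
    unfolding set_lebesgue_integral_eq_integral(2)[OF int] by (rule integral_mult_right)
  finally show ?thesis
    using f_pos[OF s] by (simp add: virtual_value_def field_simps)
qed

lemma virtual_surplus_density_integrable:
  "(\<lambda>s. (virtual_value hi lam f s - c) * f s) absolutely_integrable_on {lo..hi}"
proof -
  have "(\<lambda>s. (s - c) * f s) absolutely_integrable_on {lo..hi}"
    by (intro absolutely_integrable_mult_continuous f_int continuous_intros)
  moreover have "(\<lambda>s. E s * integral {s..hi} (\<lambda>\<xi>. f \<xi> / E \<xi>)) absolutely_integrable_on {lo..hi}"
    by (intro absolutely_integrable_continuous_real continuous_intros E_cont
        indefinite_integral_continuous_1' set_lebesgue_integral_eq_integral(1)[OF f_div_E_int])
  ultimately have "(\<lambda>s. (s - c) * f s - E s * integral {s..hi} (\<lambda>\<xi>. f \<xi> / E \<xi>))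
      absolutely_integrable_on {lo..hi}"
    by (rule set_integral_diff)
  then show ?thesis
    by (rule set_integrable_cong[THEN iffD1, rotated -1]) (simp_all add: virtual_value_eq)
qed

lemma rent_integrable:
  "quantity q \<Longrightarrow> (\<lambda>\<theta>. rent q \<theta> * f \<theta>) absolutely_integrable_on {lo..hi}"
  by (intro absolutely_integrable_mult_continuous f_int rent_cont)

text \<open>A unit of quantity at \<open>s\<close> adds \<open>E s / E \<theta>\<close> to the rent
  of each higher type \<open>\<theta>\<close>. Swapping the integrals charges these additions to
  \<open>s\<close>, which is the integral term of the virtual value.\<close>

lemma virtual_surplus_eq:
  assumes q: "quantity q"
  shows "virtual_surplus q = integral {lo..hi} (\<lambda>\<theta>. ((\<theta> - c) * q \<theta> - rent q \<theta>) * f \<theta>)"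
proof -
  let ?G = "\<lambda>s. E s * integral {s..hi} (\<lambda>\<xi>. f \<xi> / E \<xi>)"
  have A: "(\<lambda>s. q s * ((s - c) * f s)) absolutely_integrable_on {lo..hi}"
    by (intro quantity_mult q absolutely_integrable_mult_continuous f_int continuous_intros)
  have B: "(\<lambda>s. q s * ?G s) absolutely_integrable_on {lo..hi}"
    by (intro quantity_mult q absolutely_integrable_continuous_real continuous_intros E_cont
        indefinite_integral_continuous_1' set_lebesgue_integral_eq_integral(1)[OF f_div_E_int])
  have "integral {lo..hi} (\<lambda>\<theta>. rent q \<theta> * f \<theta>) =
      integral {lo..hi} (\<lambda>\<theta>. f \<theta> / E \<theta> * integral {lo..\<theta>} (\<lambda>s. E s * q s))"
    by (simp add: rent_def mult.commute)
  also have "\<dots> = integral {lo..hi} (\<lambda>s. E s * q s * integral {s..hi} (\<lambda>\<xi>. f \<xi> / E \<xi>))"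
    by (rule integral_triangle_swap[OF f_div_E_int E_quantity[OF q]])
  finally have rent: "integral {lo..hi} (\<lambda>\<theta>. rent q \<theta> * f \<theta>) = integral {lo..hi} (\<lambda>s. q s * ?G s)"
    by (simp add: mult_ac)
  have "virtual_surplus q = integral {lo..hi} (\<lambda>s. q s * ((s - c) * f s) - q s * ?G s)"
    unfolding virtual_surplus_def
    by (intro integral_cong) (simp add: virtual_value_eq right_diff_distrib)
  also have "\<dots> = integral {lo..hi} (\<lambda>s. q s * ((s - c) * f s)) - integral {lo..hi} (\<lambda>s. q s * ?G s)"
    using A B by (intro integral_diff set_lebesgue_integral_eq_integral(1))
  also have "\<dots> = integral {lo..hi} (\<lambda>s. q s * ((s - c) * f s) - rent q s * f s)"
    unfolding rent[symmetric]
    using A rent_integrable[OF q]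
    by (intro integral_diff[symmetric] set_lebesgue_integral_eq_integral(1))
  finally show ?thesis
    by (simp add: algebra_simps)
qed

text \<open>The transfer is gross value minus utility, and utility is rent plus an excess. Both
  parts are shown integrable, so the default value \<open>0\<close> of the integral in
  \<open>profit\<close> does not interfere.\<close>

lemma profit_eq:
  assumes feas: "feasible lo hi lam q t"
  shows "(\<lambda>\<theta>. (\<theta> * q \<theta> - t \<theta> - rent q \<theta>) * f \<theta>) absolutely_integrable_on {lo..hi}"
    and "profit lo hi f c q t =
      virtual_surplus q - integral {lo..hi} (\<lambda>\<theta>. (\<theta> * q \<theta> - t \<theta> - rent q \<theta>) * f \<theta>)"
proof -
  have q: "quantity q"
    using feas mechanism_imp_quantity by (auto simp: feasible_def)
  show slack: "(\<lambda>\<theta>. (\<theta> * q \<theta> - t \<theta> - rent q \<theta>) * f \<theta>) absolutely_integrable_on {lo..hi}"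
    using set_integral_diff(1)[OF utility_integrable[OF feas] rent_integrable[OF q]]
    by (simp add: left_diff_distrib)
  have "(\<lambda>\<theta>. (\<theta> - c) * f \<theta>) absolutely_integrable_on {lo..hi}"
    by (intro absolutely_integrable_mult_continuous f_int continuous_intros)
  from set_integral_diff(1)[OF quantity_mult[OF q this] rent_integrable[OF q]]
  have gain: "(\<lambda>\<theta>. ((\<theta> - c) * q \<theta> - rent q \<theta>) * f \<theta>) absolutely_integrable_on {lo..hi}"
    by (simp add: algebra_simps)
  have eq: "(\<lambda>\<theta>. (t \<theta> - c * q \<theta>) * f \<theta>) =
      (\<lambda>\<theta>. ((\<theta> - c) * q \<theta> - rent q \<theta>) * f \<theta> - (\<theta> * q \<theta> - t \<theta> - rent q \<theta>) * f \<theta>)"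
    by (simp add: algebra_simps)
  show "profit lo hi f c q t =
      virtual_surplus q - integral {lo..hi} (\<lambda>\<theta>. (\<theta> * q \<theta> - t \<theta> - rent q \<theta>) * f \<theta>)"
    unfolding profit_def eq virtual_surplus_eq[OF q]
    by (simp add: set_integral_diff(2)[OF gain slack] set_lebesgue_integral_eq_integral(2) gain slack)
qed

section \<open>Implementing increasing quantity functions\<close>

lemma mono_quantity_feasible:
  assumes meas: "q \<in> borel_measurable (restrict_space borel {lo..hi})"
    and range: "\<And>\<theta>. \<theta> \<in> {lo..hi} \<Longrightarrow> q \<theta> \<in> {0..1}"
    and mono: "mono_on {lo..hi} q"
  shows "feasible lo hi lam q (\<lambda>\<theta>. \<theta> * q \<theta> - rent q \<theta>)"
proof -
  let ?I = "\<lambda>\<theta>. integral {lo..\<theta>} (\<lambda>s. E s * q s)"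
  have umeas: "universally_measurable_on {lo..hi} q"
    using meas by (rule borel_imp_universally_measurable_on)
  then have q: "quantity q"
    using range by (auto simp: quantity_def intro: universally_measurable_on_imp_lebesgue)
  have "rent q \<in> borel_measurable (restrict_space borel {lo..hi})"
    using rent_cont[OF q] by (rule borel_measurable_continuous_on_restrict)
  then have "universally_measurable_on {lo..hi} (\<lambda>\<theta>. \<theta> * q \<theta> - rent q \<theta>)"
    using meas measurable_restrict_space1[OF measurable_ident_sets[OF refl], of borel]
    by (intro borel_imp_universally_measurable_on borel_measurable_diff borel_measurable_times)
  then have "mechanism lo hi q (\<lambda>\<theta>. \<theta> * q \<theta> - rent q \<theta>)"
    using umeas range by (auto simp: mechanism_def)
  \<comment> \<open>\<open>E * q\<close> is increasing, so its integral over \<open>{x..y}\<close>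
    lies between the endpoint values times the length. The lower bound deters downward misreports,
    the upper bound upward ones.\<close>
  moreover have incr: "E x * q x * (y - x) \<le> ?I y - ?I x" "?I y - ?I x \<le> E y * q y * (y - x)"
    if "lo \<le> x" "x \<le> y" "y \<le> hi" for x y
  proof -
    have le: "E s * q s \<le> E s' * q s'" if "x \<le> s" "s \<le> s'" "s' \<le> y" for s s'
      using that \<open>lo \<le> x\<close> \<open>y \<le> hi\<close> range[of s]
      by (intro mult_mono E_mono mono_onD[OF mono]) auto
    have "?I y - ?I x = integral {x..y} (\<lambda>s. E s * q s)"
      using Henstock_Kurzweil_Integration.integral_combine[OF _ _ E_quantity_integrable[OF q, of lo y], of x] that by simp
    moreover have "integral {x..y} (\<lambda>s. E x * q x) \<le> integral {x..y} (\<lambda>s. E s * q s)"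
      using that le by (intro integral_le E_quantity_integrable q) auto
    moreover have "integral {x..y} (\<lambda>s. E s * q s) \<le> integral {x..y} (\<lambda>s. E y * q y)"
      using that le by (intro integral_le E_quantity_integrable q) auto
    ultimately show "E x * q x * (y - x) \<le> ?I y - ?I x" "?I y - ?I x \<le> E y * q y * (y - x)"
      using that by (auto simp: mult_ac)
  qed
  have "incentive_compatible lo hi lam q (\<lambda>\<theta>. \<theta> * q \<theta> - rent q \<theta>)"
    unfolding incentive_compatible_def
  proof (intro ballI)
    fix x y assume x: "x \<in> {lo..hi}" and y: "y \<in> {lo..hi}"
    \<comment> \<open>Here \<open>x\<close> is the true type and \<open>y\<close> the report.
      Authenticated as \<open>y\<close>, type \<open>x\<close> gets
      \<open>rent q y + (x - y) * q y\<close>.\<close>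
    have "auth_rate lam y x * (x * q y - (y * q y - rent q y)) \<le> rent q x"
    proof (cases "y \<le> x")
      case True
      have rate: "auth_rate lam y x = E y / E x"
        using True x y by (simp add: auth_rate_below)
      have "rent q y + (x - y) * q y = (?I y + E y * q y * (x - y)) / E y"
        by (simp add: rent_def add_divide_distrib)
      also have "\<dots> \<le> ?I x / E y"
        using True x y incr(1)[of y x] by (intro divide_right_mono) auto
      finally have "rent q y + (x - y) * q y \<le> ?I x / E y" .
      then have "auth_rate lam y x * (rent q y + (x - y) * q y) \<le> E y / E x * (?I x / E y)"
        unfolding rate by (rule mult_left_mono) simp
      also have "\<dots> = rent q x"
        by (simp add: rent_def)
      finally show ?thesis
        by (simp add: algebra_simps)
    next
      case False
      then have "E x \<le> E y"
        using x y by (intro E_mono) auto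
      have rate: "auth_rate lam y x = E x / E y"
        using False x y by (simp add: auth_rate_above)
      have "rent q y - (y - x) * q y = (?I y - E y * q y * (y - x)) / E y"
        by (simp add: rent_def diff_divide_distrib)
      also have "\<dots> \<le> ?I x / E y"
        using False x y incr(2)[of x y] by (intro divide_right_mono) auto
      finally have "rent q y - (y - x) * q y \<le> ?I x / E y" .
      then have "auth_rate lam y x * (rent q y - (y - x) * q y) \<le> E x / E y * (?I x / E y)"
        unfolding rate by (rule mult_left_mono) simp
      \<comment> \<open>One factor \<open>E x / E y\<close> is the authentication rate; the other
        arises because \<open>?I x\<close> is divided by \<open>E y\<close> instead of
        \<open>E x\<close>. Both are at most \<open>1\<close>.\<close>
      also have "\<dots> = (E x / E y)\<^sup>2 * rent q x"
        by (simp add: rent_def power2_eq_square field_simps)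
      also have "\<dots> \<le> 1 * rent q x"
        using \<open>E x \<le> E y\<close> rent_nonneg[OF q x] by (intro mult_right_mono power_le_one) auto
      finally show ?thesis
        by (simp add: algebra_simps)
    qed
    then show "auth_rate lam y x * (x * q y - (y * q y - rent q y)) \<le> x * q x - (x * q x - rent q x)"
      by simp
  qed
  moreover have "individually_rational lo hi q (\<lambda>\<theta>. \<theta> * q \<theta> - rent q \<theta>)"
    using rent_nonneg[OF q] by (simp add: individually_rational_def)
  ultimately show ?thesis
    by (simp add: feasible_def)
qed

section \<open>The threshold and the cutoff mechanism\<close>

abbreviation "\<theta>s \<equiv> threshold lo hi (virtual_value hi lam f) c"

text \<open>No type lies above \<open>hi\<close>, so the integral term vanishes. With
  \<open>c < hi\<close> this makes the set defining the threshold nonempty.\<close>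

lemma virtual_value_hi: "virtual_value hi lam f hi = hi"
  using virtual_value_eq[of hi] f_pos[of hi] lo_less_hi by simp

text \<open>Below the infimum no type has virtual value at least \<open>c\<close>. Above it, some
  smaller type does, and strict monotonicity makes the inequality strict. At
  \<open>\<theta>s\<close> itself the sign is left open.\<close>

lemma threshold_mem: "\<theta>s \<in> {lo..hi}"
  and virtual_value_less: "\<lbrakk>\<theta> \<in> {lo..hi}; \<theta> < \<theta>s\<rbrakk> \<Longrightarrow> virtual_value hi lam f \<theta> < c"
  and virtual_value_greater: "\<lbrakk>\<theta> \<in> {lo..hi}; \<theta>s < \<theta>\<rbrakk> \<Longrightarrow> c < virtual_value hi lam f \<theta>"
proof -
  let ?S = "{\<theta>\<in>{lo..hi}. c \<le> virtual_value hi lam f \<theta>}"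
  have hi: "hi \<in> ?S"
    using virtual_value_hi lo_less_hi c_less_hi by simp
  have bdd: "bdd_below ?S"
    by (rule bdd_belowI[of _ lo]) simp
  have "lo \<le> Inf ?S"
    by (rule cInf_greatest) (use hi in auto)
  then show "\<theta>s \<in> {lo..hi}"
    using cInf_lower[OF hi bdd] by (simp add: threshold_def)
  show "virtual_value hi lam f \<theta> < c" if \<theta>: "\<theta> \<in> {lo..hi}" "\<theta> < \<theta>s"
  proof (rule ccontr)
    assume "\<not> virtual_value hi lam f \<theta> < c"
    then have "\<theta> \<in> ?S"
      using \<theta>(1) by simp
    then show False
      using cInf_lower[OF _ bdd, of \<theta>] \<theta>(2) by (simp add: threshold_def)
  qed
  show "c < virtual_value hi lam f \<theta>" if \<theta>: "\<theta> \<in> {lo..hi}" "\<theta>s < \<theta>"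
  proof -
    obtain x where x: "x \<in> ?S" "x < \<theta>"
      using \<theta>(2) cInf_lessD[of ?S \<theta>] hi unfolding threshold_def by blast
    then have "virtual_value hi lam f x < virtual_value hi lam f \<theta>"
      using \<theta>(1) by (intro strict_mono_onD[OF vv_mono]) auto
    then show ?thesis
      using x by simp
  qed
qed

abbreviation "q_opt \<equiv> opt_quantity \<theta>s"
abbreviation "t_opt \<equiv> opt_transfer lam \<theta>s"

lemma q_opt_meas: "q_opt \<in> borel_measurable (restrict_space borel {lo..hi})"
  unfolding opt_quantity_def by (intro measurable_restrict_space1) measurable

lemma q_opt_quantity: "quantity q_opt"
  using universally_measurable_on_imp_lebesgue[OF borel_imp_universally_measurable_on[OF q_opt_meas]]
  by (auto simp: quantity_def opt_quantity_def)

text \<open>For the cutoff quantity the rent is the integral of \<open>E \<xi> / E \<theta>\<close>,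
  the authentication rate, over \<open>{\<theta>s..\<theta>}\<close>. Subtracting it from
  \<open>\<theta>\<close>, written as \<open>\<theta>s\<close> plus the integral of
  \<open>1\<close>, gives the stated transfer.\<close>

lemma t_opt_eq:
  assumes \<theta>: "\<theta> \<in> {lo..hi}"
  shows "t_opt \<theta> = \<theta> * q_opt \<theta> - rent q_opt \<theta>"
proof -
  have "rent q_opt \<theta> = integral {lo..\<theta>} (\<lambda>s. if s \<in> {\<theta>s..} then E s else 0) / E \<theta>"
    unfolding rent_def opt_quantity_def
    by (intro arg_cong2[where f="(/)"] integral_cong) auto
  also have "\<dots> = integral ({\<theta>s..} \<inter> {lo..\<theta>}) E / E \<theta>"
    by (simp only: Henstock_Kurzweil_Integration.integral_restrict_Int)
  also have "{\<theta>s..} \<inter> {lo..\<theta>} = {\<theta>s..\<theta>}"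
    using threshold_mem by auto
  finally have rent: "rent q_opt \<theta> = integral {\<theta>s..\<theta>} E / E \<theta>" .
  show ?thesis
  proof (cases "\<theta> < \<theta>s")
    case True
    then show ?thesis
      by (simp add: rent opt_transfer_def opt_quantity_def)
  next
    case False
    have cont: "continuous_on {\<theta>s..\<theta>} E"
      using E_cont \<theta> threshold_mem by (auto intro: continuous_on_subset)
    have "(LBINT \<xi>=\<theta>s..\<theta>. 1 - auth_rate lam \<xi> \<theta>) = (LBINT \<xi>=\<theta>s..\<theta>. 1 - E \<xi> / E \<theta>)"
      using \<theta> False threshold_mem
      by (intro interval_integral_cong) (auto simp: auth_rate_below)
    also have "\<dots> = integral {\<theta>s..\<theta>} (\<lambda>\<xi>. 1 - E \<xi> / E \<theta>)"
      using False cont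
      by (intro interval_integral_eq_integral borel_integrable_atLeastAtMost' continuous_intros) auto
    also have "\<dots> = \<theta> - \<theta>s - integral {\<theta>s..\<theta>} E / E \<theta>"
      using False cont
      by (subst integral_diff) (auto intro!: integrable_continuous_real continuous_intros)
    finally show ?thesis
      using False by (simp add: rent opt_transfer_def opt_quantity_def)
  qed
qed

section \<open>Optimality and essential uniqueness\<close>

text \<open>Pointwise maximisation: \<open>q_opt\<close> takes the largest quantity where the
  virtual value exceeds \<open>c\<close> and the smallest where it falls short, so the two factors
  never have opposite signs.\<close>

lemma virtual_surplus_gap_nonneg:
  assumes "\<theta> \<in> {lo..hi}" and "\<theta> \<noteq> \<theta>s" and "q \<theta> \<in> {0..1}"
  shows "0 \<le> (q_opt \<theta> - q \<theta>) * ((virtual_value hi lam f \<theta> - c) * f \<theta>)"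
proof (cases "\<theta> < \<theta>s")
  case True
  then have "q_opt \<theta> - q \<theta> \<le> 0" and "(virtual_value hi lam f \<theta> - c) * f \<theta> \<le> 0"
    using virtual_value_less[of \<theta>] f_pos[of \<theta>] assms
    by (auto simp: opt_quantity_def intro: mult_nonpos_nonneg)
  then show ?thesis
    by (rule mult_nonpos_nonpos)
next
  case False
  then have "0 \<le> q_opt \<theta> - q \<theta>" and "0 \<le> (virtual_value hi lam f \<theta> - c) * f \<theta>"
    using virtual_value_greater[of \<theta>] f_pos[of \<theta>] assms
    by (auto simp: opt_quantity_def)
  then show ?thesis
    by (rule mult_nonneg_nonneg)
qed

text \<open>The absolute value only matters at the threshold: for a discontinuous density the virtual value
  there may still be below \<open>c\<close>, although \<open>q_opt\<close> is \<open>1\<close>.\<close>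

lemma optimality_gap:
  assumes feas: "feasible lo hi lam q t"
  defines "waste \<equiv> \<lambda>\<theta>. \<bar>(q_opt \<theta> - q \<theta>) * ((virtual_value hi lam f \<theta> - c) * f \<theta>)\<bar>"
    and "slack \<equiv> \<lambda>\<theta>. (\<theta> * q \<theta> - t \<theta> - rent q \<theta>) * f \<theta>"
  shows "waste absolutely_integrable_on {lo..hi}" "slack absolutely_integrable_on {lo..hi}"
    and "\<theta> \<in> {lo..hi} \<Longrightarrow> 0 \<le> waste \<theta>" "\<theta> \<in> {lo..hi} \<Longrightarrow> 0 \<le> slack \<theta>"
    and "profit lo hi f c q t =
      virtual_surplus q_opt - integral {lo..hi} waste - integral {lo..hi} slack"
proof -
  have q: "quantity q"
    using feas mechanism_imp_quantity by (auto simp: feasible_def)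
  note int = quantity_mult[OF q_opt_quantity virtual_surplus_density_integrable]
    quantity_mult[OF q virtual_surplus_density_integrable]
  show waste: "waste absolutely_integrable_on {lo..hi}"
    unfolding waste_def
    using set_integrable_abs[OF set_integral_diff(1)[OF int]] by (simp only: left_diff_distrib)
  show "slack absolutely_integrable_on {lo..hi}"
    unfolding slack_def by (rule profit_eq(1)[OF feas])
  show "0 \<le> waste \<theta>"
    by (simp add: waste_def)
  show "0 \<le> slack \<theta>" if "\<theta> \<in> {lo..hi}"
    using rent_le_utility[OF feas that] f_pos[OF that] by (simp add: slack_def)
  have "integral {lo..hi} waste =
      integral {lo..hi} (\<lambda>\<theta>. (q_opt \<theta> - q \<theta>) * ((virtual_value hi lam f \<theta> - c) * f \<theta>))"
    by (rule integral_spike[of "{\<theta>s}"])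
      (use virtual_surplus_gap_nonneg[where q = q] q in \<open>auto simp: waste_def quantity_def\<close>)
  also have "\<dots> = virtual_surplus q_opt - virtual_surplus q"
    unfolding virtual_surplus_def left_diff_distrib[of "q_opt _"]
    by (intro integral_diff set_lebesgue_integral_eq_integral(1) int)
  finally have "integral {lo..hi} waste = virtual_surplus q_opt - virtual_surplus q" .
  then show "profit lo hi f c q t =
      virtual_surplus q_opt - integral {lo..hi} waste - integral {lo..hi} slack"
    using profit_eq(2)[OF feas] by (simp add: slack_def)
qed

text \<open>The cutoff quantity is increasing, hence implemented by its rent, and
  \<open>t_opt\<close> is the corresponding transfer on the type interval. Utility then equals rent,
  so no surplus is lost as slack.\<close>

lemma opt_feasible: "feasible lo hi lam q_opt t_opt"
  and opt_profit: "profit lo hi f c q_opt t_opt = virtual_surplus q_opt"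
proof -
  have "feasible lo hi lam q_opt (\<lambda>\<theta>. \<theta> * q_opt \<theta> - rent q_opt \<theta>)"
    by (intro mono_quantity_feasible q_opt_meas mono_onI) (auto simp: opt_quantity_def)
  then have ic: "incentive_compatible lo hi lam q_opt t_opt"
    and ir: "individually_rational lo hi q_opt t_opt"
    and mech: "mechanism lo hi q_opt (\<lambda>\<theta>. \<theta> * q_opt \<theta> - rent q_opt \<theta>)"
    by (auto simp: feasible_def incentive_compatible_def individually_rational_def t_opt_eq)
  have "universally_measurable_on {lo..hi} t_opt"
    using mech t_opt_eq universally_measurable_on_cong[of "{lo..hi}" t_opt]
    by (simp add: mechanism_def)
  then show feas: "feasible lo hi lam q_opt t_opt"
    using mech ic ir by (simp add: feasible_def mechanism_def)
  have "integral {lo..hi} (\<lambda>\<theta>. (\<theta> * q_opt \<theta> - t_opt \<theta> - rent q_opt \<theta>) * f \<theta>) =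
      integral {lo..hi} (\<lambda>_. 0)"
    by (intro integral_cong) (simp add: t_opt_eq)
  then show "profit lo hi f c q_opt t_opt = virtual_surplus q_opt"
    using profit_eq(2)[OF feas] by simp
qed

text \<open>\<open>optimality_gap\<close> subtracts two nonnegative integrals from
  \<open>virtual_surplus q_opt\<close>, the profit that the cutoff mechanism attains.\<close>

lemma opt_optimal: "optimal lo hi lam f c q_opt t_opt"
  unfolding optimal_def
proof (intro conjI allI impI)
  fix q t assume feas: "feasible lo hi lam q t"
  show "profit lo hi f c q t \<le> profit lo hi f c q_opt t_opt"
    unfolding optimality_gap(5)[OF feas] opt_profit
    using integral_nonneg[OF set_lebesgue_integral_eq_integral(1)[OF optimality_gap(1)[OF feas]]]
      integral_nonneg[OF set_lebesgue_integral_eq_integral(1)[OF optimality_gap(2)[OF feas]]]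
      optimality_gap(3,4)[OF feas]
    by force
qed (rule opt_feasible)

text \<open>An optimal mechanism must have zero total waste and zero total slack. Vanishing waste
  determines \<open>q\<close> almost everywhere, and vanishing slack then determines
  \<open>t\<close>.\<close>

lemma opt_unique:
  assumes opt: "optimal lo hi lam f c q t"
  shows "AE \<theta> in lebesgue. \<theta> \<in> {lo..hi} \<longrightarrow> q \<theta> = q_opt \<theta> \<and> t \<theta> = t_opt \<theta>"
proof -
  let ?waste = "\<lambda>\<theta>. \<bar>(q_opt \<theta> - q \<theta>) * ((virtual_value hi lam f \<theta> - c) * f \<theta>)\<bar>"
  let ?slack = "\<lambda>\<theta>. (\<theta> * q \<theta> - t \<theta> - rent q \<theta>) * f \<theta>"
  have feas: "feasible lo hi lam q t"
    using opt by (simp add: optimal_def)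
  note gap = optimality_gap[OF feas]
  have q: "quantity q"
    using feas mechanism_imp_quantity by (auto simp: feasible_def)
  have nonneg: "0 \<le> integral {lo..hi} ?waste" "0 \<le> integral {lo..hi} ?slack"
    by (intro integral_nonneg set_lebesgue_integral_eq_integral(1) gap; assumption)+
  moreover have "profit lo hi f c q_opt t_opt \<le> profit lo hi f c q t"
    using opt opt_feasible by (simp add: optimal_def)
  ultimately have zero: "integral {lo..hi} ?waste = 0" "integral {lo..hi} ?slack = 0"
    using gap(5) opt_profit by linarith+
  have waste: "AE \<theta> in lebesgue. \<theta> \<in> {lo..hi} \<longrightarrow> ?waste \<theta> = 0"
    using gap(1,3) zero(1) by (rule integral_eq_0_AE)
  have slack: "AE \<theta> in lebesgue. \<theta> \<in> {lo..hi} \<longrightarrow> ?slack \<theta> = 0"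
    using gap(2,4) zero(2) by (rule integral_eq_0_AE)
  have "AE \<theta> in lebesgue. \<theta> \<noteq> \<theta>s"
    by (rule AE_completion[OF AE_lborel_singleton])
  \<comment> \<open>Off the threshold the virtual value differs from \<open>c\<close> and
    \<open>f\<close> is positive, so zero waste forces the quantities to agree.\<close>
  with waste have eq: "AE \<theta> in lebesgue. \<theta> \<in> {lo..hi} \<longrightarrow> q \<theta> = q_opt \<theta>"
  proof eventually_elim
    fix \<theta> assume \<theta>: "\<theta> \<in> {lo..hi} \<longrightarrow> ?waste \<theta> = 0" "\<theta> \<noteq> \<theta>s"
    show "\<theta> \<in> {lo..hi} \<longrightarrow> q \<theta> = q_opt \<theta>"
    proof
      assume mem: "\<theta> \<in> {lo..hi}"
      then have "virtual_value hi lam f \<theta> \<noteq> c"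
        using \<theta>(2) virtual_value_less[of \<theta>] virtual_value_greater[of \<theta>]
        by (cases "\<theta> < \<theta>s") auto
      then show "q \<theta> = q_opt \<theta>"
        using \<theta>(1) mem f_pos[OF mem] by auto
    qed
  qed
  \<comment> \<open>Rents depend on the quantity only through integrals, so agreement almost
    everywhere makes them equal at every type.\<close>
  have "rent q \<theta> = rent q_opt \<theta>" if "\<theta> \<in> {lo..hi}" for \<theta>
  proof -
    have "negligible {s. \<not> (s \<in> {lo..hi} \<longrightarrow> q s = q_opt s)}"
      using eq by (simp add: completion.AE_iff_null_sets negligible_iff_null_sets Compl_eq)
    then have "integral {lo..\<theta>} (\<lambda>s. E s * q s) = integral {lo..\<theta>} (\<lambda>s. E s * q_opt s)"
      by (rule integral_spike) (use that in auto)
    then show ?thesis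
      by (simp add: rent_def)
  qed
  then have "q \<theta> = q_opt \<theta> \<and> t \<theta> = t_opt \<theta>"
    if "\<theta> \<in> {lo..hi}" "q \<theta> = q_opt \<theta>" "?slack \<theta> = 0" for \<theta>
    using that f_pos[of \<theta>] by (auto simp: t_opt_eq)
  note agree = this
  from eq slack show ?thesis
    by eventually_elim (use agree in blast)
qed

end

theorem proposition6:
  fixes lo hi c :: real and lam f :: "real \<Rightarrow> real"
  assumes "0 \<le> lo" and "lo < hi"
    and "continuous_on {lo..hi} lam"
    and "\<And>\<theta>. \<theta> \<in> {lo..hi} \<Longrightarrow> 0 \<le> lam \<theta>"
    and "\<And>\<theta>. \<theta> \<in> {lo..hi} \<Longrightarrow> 0 < f \<theta>"
    and "set_integrable lebesgue {lo..hi} f"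
    and "(LINT \<theta>:{lo..hi}|lebesgue. f \<theta>) = 1"
    and "0 \<le> c" and "c < hi"
    and "strict_mono_on {lo..hi} (virtual_value hi lam f)"
  shows "let \<theta>s = threshold lo hi (virtual_value hi lam f) c;
             q_opt = opt_quantity \<theta>s;
             t_opt = opt_transfer lam \<theta>s
         in optimal lo hi lam f c q_opt t_opt \<and>
            (\<forall>q t. optimal lo hi lam f c q t \<longrightarrow>
               (AE \<theta> in lebesgue. \<theta> \<in> {lo..hi} \<longrightarrow> q \<theta> = q_opt \<theta> \<and> t \<theta> = t_opt \<theta>))"
proof -
  interpret screening lo hi c lam f
    using assms by unfold_locales
  show ?thesis
    unfolding Let_def using opt_optimal opt_unique by blast
qed

end
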